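(* For every integer $p\ge1$, $$G^{(p)}(t,u,v,z,x)=\frac{1}{1-tz}+\frac{x}{1-tzx}\,G^{(p)}_1(t,u,v,z).$$
   Context: For a finite integer sequence $(a_1,\dots,a_i)$, $\mathrm{asc}(a_1,\dots,a_i)=|\{j:1\le j<i,\ a_j<a_{j+1}\}|$. For an integer $p\ge1$, a $p$-ascent sequence of length $n\ge1$ is a sequence $(a_1,\dots,a_n)$ of nonnegative integers with $a_1=0$ and $a_i\le p+\mathrm{asc}(a_1,\dots,a_{i-1})$ for all $2\le i\le n$; the empty word is also a $p$-ascent sequence. Let $Asc(p)$ be the set of $p$-ascent sequences. For a sequence $w$, $|w|$ is its length, $\mathrm{asc}(w)$ its number of ascents, $\mathrm{last}(w)$ its last letter, $|w|_0$ its number of zeros, and $\mathrm{run}(w)=0$ if $w=0^n$ for some $n\ge0$, while $\mathrm{run}(w)=r$ if $w=0^r y v$ with $y$ a positive integer and $v$ a word. Define $G^{(p)}(t,u,v,z,x)=\sum_{w\in Asc(p)}t^{|w|}u^{\mathrm{asc}(w)}v^{\mathrm{last}(w)}z^{|w|_0}x^{\mathrm{run}(w)}$ (the empty word contributes $1$), and $G^{(p)}_1(t,u,v,z)=\sum_w t^{|w|}u^{\mathrm{asc}(w)}v^{\mathrm{last}(w)}z^{|w|_0}$ summed over $p$-ascent sequences $w$ beginning with exactly one zero followed by a nonzero letter. *)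

theory Defs
  imports "HOL-Computational_Algebra.Formal_Power_Series"
begin

text \<open>Words are lists, so the letter written \<open>a\<^sub>i\<close> in 1-based notation is \<open>w ! (i - 1)\<close>.\<close>

definition asc :: "nat list \<Rightarrow> nat" where
  "asc w = card {j. Suc j < length w \<and> w ! j < w ! Suc j}"

text \<open>With 0-based indices, the bound on the letter \<open>w ! i\<close> involves the ascents of the
  prefix \<open>take i w\<close> of all letters strictly before it.\<close>

definition Asc :: "nat \<Rightarrow> nat list set" where
  "Asc p = {w. w = [] \<or>
     (w ! 0 = 0 \<and> (\<forall>i. 1 \<le> i \<and> i < length w \<longrightarrow> w ! i \<le> p + asc (take i w)))}"

text \<open>The empty word has no last letter; the value 0 makes its weight equal to 1.\<close>

definition last_letter :: "nat list \<Rightarrow> nat" where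
  "last_letter w = (if w = [] then 0 else last w)"

definition zeros :: "nat list \<Rightarrow> nat" where
  "zeros w = count_list w 0"

definition run :: "nat list \<Rightarrow> nat" where
  "run w = (if \<exists>n. w = replicate n 0 then 0
            else (THE r. \<exists>y v. y > 0 \<and> w = replicate r 0 @ y # v))"

text \<open>Formal power series in five commuting indeterminates as nested univariate series.
  From the outside in, the indeterminates are \<open>t\<close>, \<open>u\<close>, \<open>v\<close>, \<open>z\<close>, \<open>x\<close>. The coefficients are
  rational because the library's division of power series asks for an inverse operation on
  the coefficients. All denominators below have constant coefficient 1 in \<open>t\<close>, so that
  dividing by them is multiplying by the inverse series
  (\<open>gf_denom_z\<close>, \<open>gf_denom_zx\<close> and \<open>gf_divide\<close>).\<close>

type_synonym gf_coeff = "rat fps fps fps fps"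
type_synonym gf = "gf_coeff fps"

definition cu :: gf_coeff where "cu = fps_X"
definition cv :: gf_coeff where "cv = fps_const fps_X"
definition cz :: gf_coeff where "cz = fps_const (fps_const fps_X)"
definition cx :: gf_coeff where "cx = fps_const (fps_const (fps_const fps_X))"

definition gf_t :: gf where "gf_t = fps_X"
definition gf_z :: gf where "gf_z = fps_const cz"
definition gf_x :: gf where "gf_x = fps_const cx"

text \<open>The sum over all words is graded by the exponent \<open>|w|\<close> of \<open>t\<close>; for each length it is
  finite (\<open>finite_Asc_length\<close>).\<close>

definition G :: "nat \<Rightarrow> gf" where
  "G p = Abs_fps (\<lambda>n. \<Sum>w\<in>{w \<in> Asc p. length w = n}.
           cu ^ asc w * cv ^ last_letter w * cz ^ zeros w * cx ^ run w)"

definition G1 :: "nat \<Rightarrow> gf" where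
  "G1 p = Abs_fps (\<lambda>n. \<Sum>w\<in>{w \<in> Asc p. length w = n \<and> (\<exists>y v. w = 0 # y # v \<and> y \<noteq> 0)}.
            cu ^ asc w * cv ^ last_letter w * cz ^ zeros w)"

lemma asc_le_length: "asc w \<le> length w"
proof -
  have "asc w \<le> card {..<length w}"
    unfolding asc_def by (intro card_mono) auto
  then show ?thesis by simp
qed

lemma finite_Asc_length: "finite {w \<in> Asc p. length w = n}"
proof (rule finite_subset)
  have "a \<le> p + length w" if w: "w \<in> Asc p" and a: "a \<in> set w" for w a
  proof -
    from a obtain i where i: "i < length w" "a = w ! i" by (metis in_set_conv_nth)
    show ?thesis
    proof (cases "i = 0")
      case True then show ?thesis using w i by (auto simp: Asc_def)
    next
      case False
      then have "a \<le> p + asc (take i w)" using w i by (auto simp: Asc_def)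
      then show ?thesis using asc_le_length[of "take i w"] i by simp
    qed
  qed
  then show "{w \<in> Asc p. length w = n} \<subseteq> {w. set w \<subseteq> {..p + n} \<and> length w = n}"
    by auto
qed (simp add: finite_lists_length_eq)

lemma run_replicate: "run (replicate n 0) = 0"
  by (auto simp: run_def)

lemma run_eq:
  assumes "y > 0"
  shows "run (replicate r 0 @ y # v) = r"
proof -
  have tw: "length (takeWhile (\<lambda>a. a = 0) (replicate k 0 @ b # c)) = k"
    if "b > 0" for k b :: nat and c
    using that by (induction k) auto
  have "y \<in> set (replicate r 0 @ y # v)" by simp
  then have "\<nexists>n. replicate r 0 @ y # v = replicate n 0"
    using assms by (metis in_set_replicate less_numeral_extra(3))
  then show ?thesis
    unfolding run_def using assms
    by (simp, intro the_equality) (use tw assms in metis)+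
qed

lemma gf_divide:
  fixes f g :: gf
  assumes "fps_nth g 0 = 1"
  shows "f / g = f * inverse g" and "g * inverse g = 1"
proof -
  show "f / g = f * inverse g"
    using assms by (intro fps_divide_unit) simp
  have i1: "inverse (1 :: rat fps fps) = 1" by (intro fps_inverse_one') simp
  have i2: "inverse (1 :: rat fps fps fps) = 1" by (intro fps_inverse_one' i1)
  have i3: "inverse (1 :: gf_coeff) = 1" by (intro fps_inverse_one' i2)
  show "g * inverse g = 1"
    unfolding fps_inverse_def by (intro fps_right_inverse) (simp add: assms i3)
qed

lemma gf_denom_z: "fps_nth (1 - gf_t * gf_z) 0 = 1"
  by (simp add: gf_t_def)

lemma gf_denom_zx: "fps_nth (1 - gf_t * gf_z * gf_x) 0 = 1"
  by (simp add: gf_t_def mult.assoc)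

end

(* Split Asc p into the all-zero words, whose series is 1 / (1 - tz), and the words with a
   nonzero letter, with series F. A word of the latter kind either begins with exactly one zero
   or is 0 # w for a shorter word w of the same kind. Prepending a zero to w changes neither
   the ascents nor the last letter and increases length, zeros and run by one, so
   F = x G1 + tzx F. *)

theory Submission
  imports Defs
begin

lemma asc_Nil [simp]: "asc [] = 0"
  by (simp add: asc_def)

lemma asc_singleton [simp]: "asc [a] = 0"
  by (simp add: asc_def)

text \<open>The ascent positions of \<open>b # w\<close> shift by one under \<open>Suc\<close>, and
  only position 0 is new.\<close>

lemma asc_Cons_Cons: "asc (a # b # w) = (if a < b then 1 else 0) + asc (b # w)"
proof -
  let ?B = "{j. Suc j < length (b # w) \<and> (b # w) ! j < (b # w) ! Suc j}"
  have "finite ?B"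
    by (rule finite_subset[of _ "{..<length (b # w)}"]) auto
  moreover have "{j. Suc j < length (a # b # w) \<and> (a # b # w) ! j < (a # b # w) ! Suc j}
      = (if a < b then {0} else {}) \<union> Suc ` ?B" (is "?A = _")
  proof (rule set_eqI)
    show "j \<in> ?A \<longleftrightarrow> j \<in> (if a < b then {0} else {}) \<union> Suc ` ?B" for j
      by (cases j) (auto simp: image_iff)
  qed
  ultimately show ?thesis
    unfolding asc_def by (auto simp: card_image card_insert_if)
qed

lemma asc_Cons_0:
  assumes "w \<noteq> [] \<Longrightarrow> hd w = 0"
  shows "asc (0 # w) = asc w"
  using assms by (cases w) (auto simp: asc_Cons_Cons)

lemma asc_replicate [simp]: "asc (replicate n a) = 0"
proof -
  have "{j. Suc j < n \<and> replicate n a ! j < replicate n a ! Suc j} = {}"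
    by auto
  then show ?thesis by (simp only: asc_def length_replicate card.empty)
qed

text \<open>The bound on letter \<open>i\<close> of \<open>w\<close> is the bound on letter
  \<open>Suc i\<close> of \<open>0 # w\<close>, because the extra zero in front of the prefix
  creates no ascent.\<close>

lemma Asc_Cons_0:
  assumes "w \<noteq> []" "hd w = 0"
  shows "0 # w \<in> Asc p \<longleftrightarrow> w \<in> Asc p"
proof -
  have eq: "asc (take (Suc i) (0 # w)) = asc (take i w)" for i
    using assms by (cases i) (auto intro!: asc_Cons_0)
  have "0 # w \<in> Asc p \<longleftrightarrow> (\<forall>i < length w. w ! i \<le> p + asc (take i w))"
    unfolding Asc_def
    by (auto simp: eq[simplified] less_Suc_eq_0_disj)
  \<comment> \<open>The instance \<open>i = 0\<close> is not among the defining bounds of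
    \<open>Asc p\<close>; it holds because \<open>w\<close> starts with 0.\<close>
  also have "\<dots> \<longleftrightarrow> w \<in> Asc p"
    using assms unfolding Asc_def
    by (auto simp: hd_conv_nth) (metis Suc_leI le0 neq0_conv)
  finally show ?thesis .
qed

lemma replicate_0_in_Asc: "replicate n 0 \<in> Asc p"
  by (cases n) (auto simp: Asc_def nth_Cons')

lemma Asc_hd: "w \<in> Asc p \<Longrightarrow> w \<noteq> [] \<Longrightarrow> hd w = 0"
  by (auto simp: Asc_def hd_conv_nth)

text \<open>This gives the shape to which \<open>run_eq\<close> applies, so that the description
  operator in \<open>run\<close> need not be unfolded again.\<close>

lemma nonzero_wordE:
  fixes w :: "nat list"
  assumes "\<exists>a\<in>set w. a \<noteq> 0"
  obtains r y v where "y > 0" "w = replicate r 0 @ y # v"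
proof -
  have "\<exists>r y v. y > 0 \<and> w = replicate r 0 @ y # v"
    using assms
  proof (induction w)
    case (Cons a w)
    show ?case
    proof (cases "a = 0")
      case True
      then obtain r y v where "y > 0" "w = replicate r 0 @ y # v"
        using Cons by auto
      then have "y > 0 \<and> a # w = replicate (Suc r) 0 @ y # v"
        using True by simp
      then show ?thesis by blast
    next
      case False
      then have "a > 0 \<and> a # w = replicate 0 0 @ a # w" by simp
      then show ?thesis by blast
    qed
  qed simp
  then show ?thesis using that by blast
qed

text \<open>A nonzero letter is required: by convention \<open>run\<close> is 0 on every all-zero
  word, so there it does not grow.\<close>

lemma run_Cons_0:
  assumes "\<exists>a\<in>set w. a \<noteq> 0"
  shows "run (0 # w) = Suc (run w)"
proof -
  obtain r y v where "y > 0" "w = replicate r 0 @ y # v"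
    using assms by (rule nonzero_wordE)
  then show ?thesis
    using run_eq[of y r v] run_eq[of y "Suc r" v] by simp
qed

definition weight :: "nat list \<Rightarrow> gf_coeff" where
  "weight w = cu ^ asc w * cv ^ last_letter w * cz ^ zeros w * cx ^ run w"

lemma weight_replicate_0: "weight (replicate n 0) = cz ^ n"
proof -
  have "count_list (replicate n (0::nat)) 0 = n"
    by (induction n) auto
  then show ?thesis
    by (simp add: weight_def last_letter_def zeros_def run_replicate)
qed

text \<open>The new zero adds one to \<open>zeros\<close> and \<open>run\<close>. As
  \<open>w\<close> is nonempty and starts with 0, \<open>asc\<close> and \<open>last_letter\<close>
  stay the same.\<close>

lemma weight_Cons_0:
  assumes "w \<in> Asc p" "\<exists>a\<in>set w. a \<noteq> 0"
  shows "weight (0 # w) = cz * cx * weight w"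
proof -
  have "w \<noteq> []" using assms(2) by auto
  then show ?thesis
    using asc_Cons_0[of w] Asc_hd[OF assms(1)] run_Cons_0[OF assms(2)]
    by (simp add: weight_def last_letter_def zeros_def mult_ac)
qed

definition single_zero_words :: "nat \<Rightarrow> nat \<Rightarrow> nat list set" where
  "single_zero_words p n = {w \<in> Asc p. length w = n \<and> (\<exists>y v. w = 0 # y # v \<and> y \<noteq> 0)}"

definition nonzero_words :: "nat \<Rightarrow> nat \<Rightarrow> nat list set" where
  "nonzero_words p n = {w \<in> Asc p. length w = n \<and> (\<exists>a\<in>set w. a \<noteq> 0)}"

lemma finite_single_zero_words [simp]: "finite (single_zero_words p n)"
  unfolding single_zero_words_def by (rule finite_subset[OF _ finite_Asc_length[of p n]]) auto

lemma finite_nonzero_words [simp]: "finite (nonzero_words p n)"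
  unfolding nonzero_words_def by (rule finite_subset[OF _ finite_Asc_length[of p n]]) auto

lemma nonzero_words_0: "nonzero_words p 0 = {}"
  by (auto simp: nonzero_words_def)

lemma single_zero_words_0: "single_zero_words p 0 = {}"
  by (auto simp: single_zero_words_def)

text \<open>The case split is on the second letter: if it is 0, the first zero can be removed inside
  \<open>Asc p\<close>; otherwise the initial block of zeros has length one.\<close>

lemma nonzero_words_Suc:
  "nonzero_words p (Suc n) = single_zero_words p (Suc n) \<union> (#) 0 ` nonzero_words p n"
proof (intro equalityI subsetI)
  fix w assume w: "w \<in> nonzero_words p (Suc n)"
  then obtain w' where w': "w = 0 # w'"
    using Asc_hd[of w p] by (cases w) (auto simp: nonzero_words_def)
  show "w \<in> single_zero_words p (Suc n) \<union> (#) 0 ` nonzero_words p n"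
  proof (cases "hd w' = 0")
    case True
    moreover have "w' \<noteq> []" using w w' by (auto simp: nonzero_words_def)
    ultimately have "w' \<in> nonzero_words p n"
      using w w' Asc_Cons_0[of w' p] by (auto simp: nonzero_words_def)
    then show ?thesis using w' by blast
  next
    case False
    \<comment> \<open>The case \<open>w' = []\<close> is impossible, since \<open>[0]\<close> has no
      nonzero letter.\<close>
    then show ?thesis
      using w w' by (cases w') (auto simp: nonzero_words_def single_zero_words_def)
  qed
next
  fix w assume "w \<in> single_zero_words p (Suc n) \<union> (#) 0 ` nonzero_words p n"
  then show "w \<in> nonzero_words p (Suc n)"
  proof
    assume "w \<in> (#) 0 ` nonzero_words p n"
    then obtain w' where w': "w = 0 # w'" "w' \<in> nonzero_words p n" by blast
    then have "w' \<noteq> []" by (auto simp: nonzero_words_def)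
    moreover from this have "hd w' = 0"
      using w' Asc_hd[of w' p] by (auto simp: nonzero_words_def)
    ultimately show ?thesis using w' Asc_Cons_0[of w' p] by (auto simp: nonzero_words_def)
  qed (auto simp: single_zero_words_def nonzero_words_def)
qed

text \<open>The second letter separates the two sets: it is nonzero in the first and 0 in the
  second.\<close>

lemma single_zero_words_disjoint: "single_zero_words p (Suc n) \<inter> (#) 0 ` nonzero_words p n = {}"
  using Asc_hd by (fastforce simp: single_zero_words_def nonzero_words_def)

lemma Asc_length_eq:
  "{w \<in> Asc p. length w = n} = insert (replicate n 0) (nonzero_words p n)"
  by (auto simp: nonzero_words_def replicate_0_in_Asc intro!: replicate_eqI)

text \<open>Here \<open>run\<close> equals 1, which is the source of the factor \<open>x\<close> in
  front of \<open>G1\<close>.\<close>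

lemma weight_single_zero:
  assumes "w \<in> single_zero_words p n"
  shows "weight w = cx * (cu ^ asc w * cv ^ last_letter w * cz ^ zeros w)"
proof -
  obtain y v where "w = 0 # y # v" "y \<noteq> 0"
    using assms by (auto simp: single_zero_words_def)
  then have "run w = 1" using run_eq[of y 1 v] by simp
  then show ?thesis by (simp add: weight_def mult_ac)
qed

definition F :: "nat \<Rightarrow> gf" where
  "F p = Abs_fps (\<lambda>n. \<Sum>w\<in>nonzero_words p n. weight w)"

lemma G_eq_zero_words_plus_F: "G p = Abs_fps (\<lambda>n. cz ^ n) + F p"
proof (rule fps_ext)
  fix n
  have "replicate n 0 \<notin> nonzero_words p n" by (auto simp: nonzero_words_def)
  then show "fps_nth (G p) n = fps_nth (Abs_fps (\<lambda>n. cz ^ n) + F p) n"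
    by (simp add: G_def F_def Asc_length_eq weight_replicate_0 flip: weight_def)
qed

text \<open>Multiplication by \<open>gf_t\<close> shifts coefficients by one, which matches the
  extra letter in \<open>nonzero_words_Suc\<close>; \<open>weight_Cons_0\<close> supplies the
  factors \<open>z\<close> and \<open>x\<close>.\<close>

lemma F_recursion: "F p = gf_x * G1 p + gf_t * gf_z * gf_x * F p"
proof (rule fps_ext)
  fix n
  have G1: "fps_nth (gf_x * G1 p) n = (\<Sum>w\<in>single_zero_words p n. weight w)"
    unfolding gf_x_def G1_def single_zero_words_def[symmetric]
    by (simp add: sum_distrib_left weight_single_zero)
  show "fps_nth (F p) n = fps_nth (gf_x * G1 p + gf_t * gf_z * gf_x * F p) n"
  proof (cases n)
    case 0
    then show ?thesis
      using G1 by (simp add: F_def gf_t_def mult.assoc nonzero_words_0 single_zero_words_0)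
  next
    case (Suc m)
    have "(\<Sum>w\<in>(#) 0 ` nonzero_words p m. weight w) = (\<Sum>w\<in>nonzero_words p m. cz * cx * weight w)"
      by (subst sum.reindex) (auto intro!: sum.cong weight_Cons_0 simp: nonzero_words_def)
    then show ?thesis
      using G1 by (simp add: Suc F_def gf_t_def gf_z_def gf_x_def nonzero_words_Suc
          sum.union_disjoint single_zero_words_disjoint sum_distrib_left mult.assoc)
  qed
qed

text \<open>This is the geometric series in \<open>tz\<close>, stated as a product to fit
  \<open>gf_divideI\<close>.\<close>

lemma zero_words_recursion: "Abs_fps (\<lambda>n. cz ^ n) * (1 - gf_t * gf_z) = 1"
proof -
  have "Abs_fps (\<lambda>n. cz ^ n) = 1 + gf_t * gf_z * Abs_fps (\<lambda>n. cz ^ n)"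
  proof (rule fps_ext)
    show "fps_nth (Abs_fps (\<lambda>n. cz ^ n)) n = fps_nth (1 + gf_t * gf_z * Abs_fps (\<lambda>n. cz ^ n)) n" for n
      by (cases n) (auto simp: gf_t_def gf_z_def mult.assoc)
  qed
  then have "Abs_fps (\<lambda>n. cz ^ n) - gf_t * gf_z * Abs_fps (\<lambda>n. cz ^ n) = 1"
    by (simp only: diff_eq_eq)
  then show ?thesis by (simp only: right_diff_distrib mult_1_left mult.commute)
qed

text \<open>The coefficients do not form a field; constant coefficient 1 makes
  \<open>inverse g\<close> a true inverse, so a product identity can be turned into a
  quotient.\<close>

lemma gf_divideI:
  fixes f g h :: gf
  assumes "fps_nth g 0 = 1" "h * g = f"
  shows "h = f / g"
proof -
  have "f / g = h * (g * inverse g)"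
    using assms by (simp add: gf_divide(1) mult.assoc)
  then show ?thesis using gf_divide(2)[OF assms(1)] by simp
qed

theorem theorem2p4:
  fixes p :: nat
  assumes "p \<ge> 1"
  shows "G p = 1 / (1 - gf_t * gf_z) + gf_x / (1 - gf_t * gf_z * gf_x) * G1 p"
proof -
  have "Abs_fps (\<lambda>n. cz ^ n) = 1 / (1 - gf_t * gf_z)"
    by (intro gf_divideI gf_denom_z zero_words_recursion)
  moreover have "F p * (1 - gf_t * gf_z * gf_x) = gf_x * G1 p"
    using F_recursion[of p] by (simp add: algebra_simps)
  then have "F p = gf_x * G1 p / (1 - gf_t * gf_z * gf_x)"
    by (intro gf_divideI gf_denom_zx)
  \<comment> \<open>Writing both quotients as products with the inverse series lets
    \<open>G1 p\<close> move out of the numerator.\<close>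
  then have "F p = gf_x / (1 - gf_t * gf_z * gf_x) * G1 p"
    unfolding gf_divide(1)[OF gf_denom_zx] by (simp only: mult_ac)
  ultimately show ?thesis by (simp add: G_eq_zero_words_plus_F)
qed

end
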